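(* Let $n\ge 1$, let $p\in[1,+\infty)$ and let $d_{\mathcal M}:\mathcal M^*_c(\mathbb R^n)\times\mathcal M^*_c(\mathbb R^n)\to[0,+\infty)$ be a distance function satisfying the following two properties: (i) there exists a function $f:\mathbb R_{>0}\to\mathbb R_{>0}$ such that $$d_{\mathcal M}(m\mu_1,m\mu_2)=f(m)\,W_p(\mu_1,\mu_2)$$ for every $m\in\mathbb R_{>0}$ and every $\mu_1,\mu_2\in\mathcal P_c(\mathbb R^n)$; (ii) there exists an unbounded subset $\Sigma\subseteq\mathbb R^n$ such that for every $m_0\in\mathbb R_{>0}$ there exist a radius $r>0$ and a constant $C>0$, both depending only on $m_0$, with $$\sup_{x\in\Sigma}d_{\mathcal M}(m_0\delta_x,m\delta_x)\le C$$ for every $m\in(m_0-r,m_0+r)$ (with $m>0$). Then there is a constant $\lambda>0$ such that $f(m)=\lambda$ for every $m\in\mathbb R_{>0}$.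
   Context: $\mathbb R_{>0}=(0,+\infty)$. $\mathcal M^*_c(\mathbb R^n)$ is the set of non-negative Borel measures on $\mathbb R^n$ with finite, strictly positive total mass and compact support. $\mathcal P_c(\mathbb R^n)$ is the set of Borel probability measures on $\mathbb R^n$ with compact support. $\delta_x$ is the Dirac delta centered at $x$. A distance function on a set is a metric in the usual sense (with finite values). $W_p$ denotes the $p$-Wasserstein distance on $\mathcal P_c(\mathbb R^n)$ with respect to the Euclidean distance: $W_p(\mu,\nu)=\left(\inf_{\pi}\int_{\mathbb R^n\times\mathbb R^n}|x-y|^p\,d\pi(x,y)\right)^{1/p}$, the infimum being over Borel probability measures $\pi$ on $\mathbb R^n\times\mathbb R^n$ with marginals $\mu$ and $\nu$. *)

theory Defs
  imports "HOL-Probability.Probability"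
begin

definition measure_support :: "'a::topological_space measure \<Rightarrow> 'a set" where
  "measure_support M = {x. \<forall>U. open U \<and> x \<in> U \<longrightarrow> emeasure M U > 0}"

definition compact_measures :: "'a::topological_space measure set" where
  "compact_measures =
     {M. sets M = sets borel \<and> finite_measure M \<and> emeasure M (space M) > 0
         \<and> compact (measure_support M)}"

definition compact_prob_measures :: "'a::topological_space measure set" where
  "compact_prob_measures =
     {M. sets M = sets borel \<and> prob_space M \<and> compact (measure_support M)}"

definition couplings :: "'a::topological_space measure \<Rightarrow> 'a measure \<Rightarrow> ('a \<times> 'a) measure set" where
  "couplings M N =
     {P. sets P = sets borel \<and> prob_space P \<and> distr P borel fst = M \<and> distr P borel snd = N}"

text \<open>
  The infimum is taken in the extended non-negative reals. For compactly supported
  probability measures it is finite, so that the conversion to a real number loses nothing;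
  the value is only meaningful in that case.
\<close>

definition wasserstein :: "real \<Rightarrow> 'a::metric_space measure \<Rightarrow> 'a measure \<Rightarrow> real" where
  "wasserstein p M N =
     enn2real (INF P\<in>couplings M N. \<integral>\<^sup>+ z. ennreal (dist (fst z) (snd z) powr p) \<partial>P) powr (1 / p)"

end

theory Submission
  imports Defs
begin

text \<open>
  Two points of \<open>\<Sigma>\<close> at distance \<open>D\<close> carry Dirac masses of size \<open>m\<close> at distance \<open>f m * D\<close>.
  By the triangle inequality, changing the mass from \<open>m0\<close> to a nearby \<open>m\<close> changes this number
  by at most \<open>2 * C\<close>. As \<open>D\<close> can be arbitrarily large, \<open>f m = f m0\<close>; hence \<open>f\<close> is locally
  constant on the connected set of positive reals.
\<close>

text \<open>This serves to show that the support is compact, being a single point. Any other point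
  has the neighbourhood \<open>- {x}\<close>, which is open by the T1 axiom and null for the Dirac
  mass. The case \<open>c = 1\<close> covers the Dirac mass itself.\<close>

lemma measure_support_scale_return:
  fixes x :: "'a::t1_space"
  assumes "c > 0"
  shows "measure_support (scale_measure c (return borel x)) = {x}"
proof (intro equalityI subsetI)
  fix y assume y: "y \<in> measure_support (scale_measure c (return borel x))"
  show "y \<in> {x}"
  proof (rule ccontr)
    assume "y \<notin> {x}"
    then have "open (- {x})" "y \<in> - {x}" by auto
    with y have "emeasure (scale_measure c (return borel x)) (- {x}) > 0"
      unfolding measure_support_def by blast
    then show False by simp
  qed
next
  fix y assume "y \<in> {x}"
  then show "y \<in> measure_support (scale_measure c (return borel x))"
    using assms by (auto simp: measure_support_def)
qed

lemma scale_return_in_compact_measures: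
  fixes x :: "'a::t1_space"
  assumes "0 < c" "c < \<top>"
  shows "scale_measure c (return borel x) \<in> compact_measures"
proof -
  have "finite_measure (scale_measure c (return borel x))"
    by (rule finite_measureI) (use assms in \<open>simp add: space_scale_measure ennreal_mult_eq_top_iff\<close>)
  then show ?thesis
    using assms by (simp add: compact_measures_def measure_support_scale_return space_scale_measure)
qed

lemma return_in_compact_prob_measures:
  fixes x :: "'a::t1_space"
  shows "return borel x \<in> compact_prob_measures"
  using measure_support_scale_return[of 1 x]
  by (simp add: compact_prob_measures_def prob_space_return)

text \<open>Couplings live on the Borel sets of the product topology, which in general can be finer
  than the product sigma-algebra, so measurability of the projections is derived from their
  continuity.\<close>

lemma measurable_fst_borel: "fst \<in> borel \<rightarrow>\<^sub>M borel"
  by (intro borel_measurable_continuous_onI continuous_intros)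

lemma measurable_snd_borel: "snd \<in> borel \<rightarrow>\<^sub>M borel"
  by (intro borel_measurable_continuous_onI continuous_intros)

lemma return_in_couplings:
  "return borel (x, y) \<in> couplings (return borel x) (return borel y)"
  by (simp add: couplings_def prob_space_return distr_return measurable_fst_borel measurable_snd_borel)

text \<open>Each marginal is a Dirac mass, so each coordinate is almost surely constant; the two
  null sets combine, whatever the joint law.\<close>

lemma AE_couplings_return:
  fixes x y :: "'a::t1_space"
  assumes "P \<in> couplings (return borel x) (return borel y)"
  shows "AE z in P. z = (x, y)"
proof -
  have sets: "sets P = sets borel"
    and fst: "distr P borel fst = return borel x" and snd: "distr P borel snd = return borel y"
    using assms by (auto simp: couplings_def)
  have "AE u in distr P borel fst. u = x" "AE u in distr P borel snd. u = y"
    unfolding fst snd by (simp_all add: AE_return)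
  then have "AE z in P. fst z = x" "AE z in P. snd z = y"
    by (simp_all add: AE_distr_iff measurable_fst_borel measurable_snd_borel measurable_cong_sets[OF sets refl])
  then show ?thesis by eventually_elim auto
qed

lemma wasserstein_return:
  assumes "p > 0"
  shows "wasserstein p (return borel x) (return borel y) = dist x y"
proof -
  have "(\<integral>\<^sup>+ z. ennreal (dist (fst z) (snd z) powr p) \<partial>P) = ennreal (dist x y powr p)"
    if P: "P \<in> couplings (return borel x) (return borel y)" for P
  proof -
    interpret prob_space P using P by (simp add: couplings_def)
    have "(\<integral>\<^sup>+ z. ennreal (dist (fst z) (snd z) powr p) \<partial>P) = (\<integral>\<^sup>+ z. ennreal (dist x y powr p) \<partial>P)"
      by (rule nn_integral_cong_AE) (use AE_couplings_return[OF P] in eventually_elim, simp)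
    then show ?thesis by (simp add: emeasure_space_1)
  qed
  \<comment> \<open>All couplings have the same cost. The explicit coupling is still required: over
    an empty set the infimum would be \<top>, which \<open>enn2real\<close> sends to 0.\<close>
  then have "(INF P\<in>couplings (return borel x) (return borel y).
      \<integral>\<^sup>+ z. ennreal (dist (fst z) (snd z) powr p) \<partial>P) = ennreal (dist x y powr p)"
    using return_in_couplings[of x y] by (auto intro!: INF_eqI)
  then show ?thesis
    using assms by (simp add: wasserstein_def powr_powr)
qed

text \<open>Any point of S can serve as x: if no y were farther than K from it, S would lie in a
  ball.\<close>

lemma unbounded_ex_dist_gt:
  assumes "\<not> bounded S"
  obtains x y where "x \<in> S" "y \<in> S" "dist x y > K"
proof -
  obtain x where "x \<in> S" using assms by (metis bounded_empty ex_in_conv)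
  with assms that show ?thesis by (meson bounded_def not_le)
qed

theorem theorem1p1:
  fixes p :: real
    and d :: "(real ^ 'n) measure \<Rightarrow> (real ^ 'n) measure \<Rightarrow> real"
    and f :: "real \<Rightarrow> real"
  assumes p: "p \<ge> 1"
    and metric: "Metric_space (compact_measures :: (real ^ 'n) measure set) d"
    and f_pos: "\<forall>m>0. f m > 0"
    and scaling: "\<forall>m>0. \<forall>\<mu>1\<in>compact_prob_measures. \<forall>\<mu>2\<in>compact_prob_measures.
           d (scale_measure (ennreal m) \<mu>1) (scale_measure (ennreal m) \<mu>2)
             = f m * wasserstein p \<mu>1 \<mu>2"
    and local_bound: "\<exists>\<Sigma> :: (real ^ 'n) set. \<not> bounded \<Sigma> \<and>
           (\<forall>m0>0. \<exists>r>0. \<exists>C>0. \<forall>m\<in>{m0 - r<..<m0 + r}. m > 0 \<longrightarrow>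
              (SUP x\<in>\<Sigma>. ereal (d (scale_measure (ennreal m0) (return borel x))
                                (scale_measure (ennreal m) (return borel x)))) \<le> ereal C)"
  shows "\<exists>c>0. \<forall>m>0. f m = c"
proof -
  define \<delta> where "\<delta> m x = scale_measure (ennreal m) (return borel x)" for m and x :: "real ^ 'n"
  interpret Metric_space "compact_measures :: (real ^ 'n) measure set" d by (rule metric)
  have in_space: "\<delta> m x \<in> compact_measures" if "m > 0" for m x
    unfolding \<delta>_def using that by (intro scale_return_in_compact_measures) auto
  have dirac: "d (\<delta> m x) (\<delta> m y) = f m * dist x y" if "m > 0" for m x y
    unfolding \<delta>_def using scaling that p by (simp add: return_in_compact_prob_measures wasserstein_return)
  obtain \<Sigma> :: "(real ^ 'n) set" where unbounded: "\<not> bounded \<Sigma>"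
    and bound: "\<forall>m0>0. \<exists>r>0. \<exists>C>0. \<forall>m\<in>{m0 - r<..<m0 + r}. m > 0 \<longrightarrow>
          (SUP x\<in>\<Sigma>. ereal (d (\<delta> m0 x) (\<delta> m x))) \<le> ereal C"
    using local_bound unfolding \<delta>_def by blast
  have eq: "f m = f m0"
    if pos: "m > 0" "m0 > 0" and sup: "(SUP x\<in>\<Sigma>. ereal (d (\<delta> m0 x) (\<delta> m x))) \<le> ereal C" for m m0 C
  proof (rule ccontr)
    assume neq: "f m \<noteq> f m0"
    \<comment> \<open>In the extended reals the supremum always exists, so bounding it by C amounts
      to bounding every term.\<close>
    have C: "d (\<delta> m0 x) (\<delta> m x) \<le> C" if "x \<in> \<Sigma>" for x
      using sup that by (simp add: SUP_le_iff)
    \<comment> \<open>The threshold makes \<open>\<bar>f m - f m0\<bar> * dist x y\<close> exceed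
      \<open>2 * C\<close>, the total cost of changing the mass once at x and once at y.\<close>
    obtain x y where xy: "x \<in> \<Sigma>" "y \<in> \<Sigma>" "dist x y > 2 * C / \<bar>f m - f m0\<bar>"
      using unbounded_ex_dist_gt[OF unbounded] by blast
    \<comment> \<open>Detour: change the mass at x, travel to y with the new mass, change it back at
      y. The same detour with m and m0 exchanged gives the bound on the absolute value.\<close>
    have "d (\<delta> m x) (\<delta> m y) \<le> d (\<delta> m x) (\<delta> m0 x) + (d (\<delta> m0 x) (\<delta> m0 y) + d (\<delta> m0 y) (\<delta> m y))"
      using triangle[of "\<delta> m x" "\<delta> m0 x" "\<delta> m y"] triangle[of "\<delta> m0 x" "\<delta> m0 y" "\<delta> m y"]
        in_space pos by fastforce
    moreover have "d (\<delta> m0 x) (\<delta> m0 y) \<le> d (\<delta> m0 x) (\<delta> m x) + (d (\<delta> m x) (\<delta> m y) + d (\<delta> m y) (\<delta> m0 y))"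
      using triangle[of "\<delta> m0 x" "\<delta> m x" "\<delta> m0 y"] triangle[of "\<delta> m x" "\<delta> m y" "\<delta> m0 y"]
        in_space pos by fastforce
    ultimately have "\<bar>d (\<delta> m x) (\<delta> m y) - d (\<delta> m0 x) (\<delta> m0 y)\<bar> \<le> 2 * C"
      using C[OF xy(1)] C[OF xy(2)] commute[of "\<delta> m x" "\<delta> m0 x"] commute[of "\<delta> m y" "\<delta> m0 y"]
      by linarith
    then have "\<bar>f m - f m0\<bar> * dist x y \<le> 2 * C"
      using dirac pos by (simp add: abs_mult flip: left_diff_distrib)
    with xy(3) neq show False by (simp add: divide_less_eq mult.commute)
  qed
  have "f m = f 1" if "m > 0" for m
  proof (rule connected_local_const[where A = "{0<..}" and f = f])
    show "\<forall>a\<in>{0<..}. eventually (\<lambda>b. f a = f b) (at a within {0<..})"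
    proof
      fix a :: real assume "a \<in> {0<..}"
      then have a: "a > 0" by simp
      then obtain r C where "r > 0" and r: "\<forall>m\<in>{a - r<..<a + r}. m > 0 \<longrightarrow>
          (SUP x\<in>\<Sigma>. ereal (d (\<delta> a x) (\<delta> m x))) \<le> ereal C"
        using bound by meson
      show "eventually (\<lambda>b. f a = f b) (at a within {0<..})"
        unfolding eventually_at
      \<comment> \<open>The radius on which the mass change is bounded is also one on which f is
        constant, since \<open>eq\<close> asks only for some finite C.\<close>
      proof (intro exI[of _ r] conjI ballI impI)
        fix b assume "b \<in> {0<..}" "b \<noteq> a \<and> dist b a < r"
        then have "b > 0" "b \<in> {a - r<..<a + r}" by (auto simp: dist_real_def)
        then show "f a = f b" using eq[of b a C] r a by simp
      qed (rule \<open>r > 0\<close>)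
    qed
  qed (use that in auto)
  with f_pos show ?thesis by (metis zero_less_one)
qed

end
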